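(* Let $X$ be a Banach space and let $\mathcal{U}=\{U(t,s)\}_{t\ge s\ge 0}$ be a nonuniform exponentially bounded evolution family on $X$. Then $\mathcal{U}$ is nonuniform exponentially stable if and only if there exist $\alpha\in\mathcal{A}(\mathcal{U})$ and $p,K>0$ such that $$\int_t^\infty \varphi_\alpha^p(\xi,\Phi(t)u)\,d\xi\le K\,\varphi_\alpha^p(t,u)\quad\text{for all } t\ge 0 \text{ and } u\in\mathcal{C}_b(\mathcal{U},\alpha).$$
   Context: $X$ is a Banach space, $\mathcal{L}(X)$ is the algebra of bounded linear operators on $X$, and $\mathbb{R}_+=[0,\infty)$. $C(\mathbb{R}_+,X)$ is the space of all continuous functions $u:\mathbb{R}_+\to X$. An evolution family is a family $\mathcal{U}=\{U(t,s)\}_{t\ge s\ge 0}$ in $\mathcal{L}(X)$ such that $U(t,t)=\mathrm{Id}$ for $t\ge 0$; $U(t,\tau)U(\tau,s)=U(t,s)$ for $t\ge\tau\ge s\ge 0$; and for each $x\in X$ the map $(t,s)\mapsto U(t,s)x$ is continuous on $\{(t,s)\in\mathbb{R}_+^2: t\ge s\}$. A number $\alpha\in\mathbb{R}$ is an admissible exponent for $\mathcal{U}$ if there is a continuous function $M:\mathbb{R}_+\to(0,\infty)$ with $\|U(t,s)\|\le M(s)e^{\alpha(t-s)}$ for all $t\ge s\ge 0$. $\mathcal{A}(\mathcal{U})$ is the set of all admissible exponents. $\mathcal{U}$ is nonuniform exponentially bounded if $\mathcal{A}(\mathcal{U})\ne\emptyset$, and nonuniform exponentially stable if $\mathcal{A}(\mathcal{U})$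 contains a negative number. For $\alpha\in\mathcal{A}(\mathcal{U})$, $t\ge 0$, $u\in C(\mathbb{R}_+,X)$, set $\varphi_\alpha(t,u)=\sup_{\tau\ge t}e^{-\alpha(\tau-t)}\|U(\tau,t)u(t)\|$; the map $t\mapsto\varphi_\alpha(t,u)$ is known to be continuous on $\mathbb{R}_+$ for every $u\in C(\mathbb{R}_+,X)$. $\varphi_\alpha^p(t,u)$ means $(\varphi_\alpha(t,u))^p$. Let $\mathcal{C}_b(\mathcal{U},\alpha)=\{u\in C(\mathbb{R}_+,X):\sup_{t\ge 0}\varphi_\alpha(t,u)<\infty\}$. For $t\ge 0$ the operator $\Phi(t):C(\mathbb{R}_+,X)\to C(\mathbb{R}_+,X)$ is defined by $(\Phi(t)u)(\xi)=U(\xi,t)u(t)$ for $\xi\ge t$ and $(\Phi(t)u)(\xi)=u(\xi)$ for $0\le\xi<t$. *)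

theory Defs
  imports "HOL-Analysis.Analysis"
begin

text \<open>
  The half-line of nonnegative reals is the set \<open>{0..}\<close>. Two-parameter families and functions on it
  are represented by total functions on the reals; only the values at \<open>t \<ge> s \<ge> 0\<close>, respectively
  at nonnegative arguments, play a role.
\<close>

definition evolution_family :: "(real \<Rightarrow> real \<Rightarrow> 'a::banach \<Rightarrow>\<^sub>L 'a) \<Rightarrow> bool" where
  "evolution_family U \<longleftrightarrow>
     (\<forall>t\<ge>0. U t t = id_blinfun) \<and>
     (\<forall>t \<tau> s. 0 \<le> s \<and> s \<le> \<tau> \<and> \<tau> \<le> t \<longrightarrow> U t \<tau> o\<^sub>L U \<tau> s = U t s) \<and>
     (\<forall>x. continuous_on {(t, s). 0 \<le> s \<and> s \<le> t} (\<lambda>(t, s). blinfun_apply (U t s) x))"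

definition admissible_exponents :: "(real \<Rightarrow> real \<Rightarrow> 'a::banach \<Rightarrow>\<^sub>L 'a) \<Rightarrow> real set" where
  "admissible_exponents U =
     {\<alpha>. \<exists>M :: real \<Rightarrow> real. continuous_on {0..} M \<and> (\<forall>s\<ge>0. M s > 0) \<and>
            (\<forall>t s. 0 \<le> s \<and> s \<le> t \<longrightarrow> norm (U t s) \<le> M s * exp (\<alpha> * (t - s)))}"

definition nonuniform_exponentially_bounded :: "(real \<Rightarrow> real \<Rightarrow> 'a::banach \<Rightarrow>\<^sub>L 'a) \<Rightarrow> bool" where
  "nonuniform_exponentially_bounded U \<longleftrightarrow> admissible_exponents U \<noteq> {}"

definition nonuniform_exponentially_stable :: "(real \<Rightarrow> real \<Rightarrow> 'a::banach \<Rightarrow>\<^sub>L 'a) \<Rightarrow> bool" where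
  "nonuniform_exponentially_stable U \<longleftrightarrow> (\<exists>\<alpha>\<in>admissible_exponents U. \<alpha> < 0)"

definition cont_halfline :: "(real \<Rightarrow> 'a::banach) set" where
  "cont_halfline = {u. continuous_on {0..} u}"

text \<open>
  The supremum below is taken in the reals; it is a genuine supremum whenever \<open>\<alpha>\<close> is admissible
  (see \<open>phi_bdd_above\<close>).
\<close>

definition phi :: "(real \<Rightarrow> real \<Rightarrow> 'a::banach \<Rightarrow>\<^sub>L 'a) \<Rightarrow> real \<Rightarrow> real \<Rightarrow> (real \<Rightarrow> 'a) \<Rightarrow> real" where
  "phi U \<alpha> t u = (SUP \<tau>\<in>{t..}. exp (- \<alpha> * (\<tau> - t)) * norm (blinfun_apply (U \<tau> t) (u t)))"

definition Cb :: "(real \<Rightarrow> real \<Rightarrow> 'a::banach \<Rightarrow>\<^sub>L 'a) \<Rightarrow> real \<Rightarrow> (real \<Rightarrow> 'a) set" where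
  "Cb U \<alpha> = {u \<in> cont_halfline. bdd_above ((\<lambda>t. phi U \<alpha> t u) ` {0..})}"

definition Phi :: "(real \<Rightarrow> real \<Rightarrow> 'a::banach \<Rightarrow>\<^sub>L 'a) \<Rightarrow> real \<Rightarrow> (real \<Rightarrow> 'a) \<Rightarrow> (real \<Rightarrow> 'a)" where
  "Phi U t u = (\<lambda>\<xi>. if t \<le> \<xi> then blinfun_apply (U \<xi> t) (u t) else u \<xi>)"

lemma phi_bdd_above:
  assumes "\<alpha> \<in> admissible_exponents U" "t \<ge> 0"
  shows "bdd_above ((\<lambda>\<tau>. exp (- \<alpha> * (\<tau> - t)) * norm (blinfun_apply (U \<tau> t) (u t))) ` {t..})"
proof -
  obtain M :: "real \<Rightarrow> real" where
    M: "\<And>\<tau> s. 0 \<le> s \<Longrightarrow> s \<le> \<tau> \<Longrightarrow> norm (U \<tau> s) \<le> M s * exp (\<alpha> * (\<tau> - s))"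
    using assms(1) unfolding admissible_exponents_def by blast
  have "exp (- \<alpha> * (\<tau> - t)) * norm (blinfun_apply (U \<tau> t) (u t)) \<le> M t * norm (u t)"
    if "t \<le> \<tau>" for \<tau>
  proof -
    have "norm (blinfun_apply (U \<tau> t) (u t)) \<le> norm (U \<tau> t) * norm (u t)"
      by (rule norm_blinfun)
    also have "\<dots> \<le> M t * exp (\<alpha> * (\<tau> - t)) * norm (u t)"
      using M[OF assms(2) that] by (rule mult_right_mono) simp
    finally have "exp (- \<alpha> * (\<tau> - t)) * norm (blinfun_apply (U \<tau> t) (u t))
        \<le> exp (- \<alpha> * (\<tau> - t)) * (M t * exp (\<alpha> * (\<tau> - t)) * norm (u t))"
      by (rule mult_left_mono) simp
    also have "\<dots> = M t * norm (u t)"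
      by (simp add: exp_minus)
    finally show ?thesis .
  qed
  then show ?thesis
    by (intro bdd_aboveI2[where M = "M t * norm (u t)"]) auto
qed

lemma Phi_cont_halfline:
  assumes U: "evolution_family U" and t: "t \<ge> 0" and u: "u \<in> cont_halfline"
  shows "Phi U t u \<in> cont_halfline"
proof -
  have cu: "continuous_on {0..t} u"
    using u unfolding cont_halfline_def by (auto intro: continuous_on_subset)
  have "continuous_on {(\<tau>, s). 0 \<le> s \<and> s \<le> \<tau>} (\<lambda>(\<tau>, s). blinfun_apply (U \<tau> s) (u t))"
    using U unfolding evolution_family_def by blast
  then have cU: "continuous_on {t..} (\<lambda>\<xi>. blinfun_apply (U \<xi> t) (u t))"
    using continuous_on_compose2[of "{(\<tau>, s). 0 \<le> s \<and> s \<le> \<tau>}"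
        "\<lambda>(\<tau>, s). blinfun_apply (U \<tau> s) (u t)" "{t..}" "\<lambda>\<xi>. (\<xi>, t)"] t
    by (simp add: image_subset_iff continuous_on_Pair)
  have id: "U t t = id_blinfun"
    using U t unfolding evolution_family_def by blast
  have "continuous_on ({t..} \<union> {0..t}) (Phi U t u)"
    unfolding Phi_def by (rule continuous_on_If) (use cu cU id in auto)
  moreover have "{t..} \<union> {0..t} = {0..}"
    using t by auto
  ultimately show ?thesis
    unfolding cont_halfline_def by simp
qed

end

theory Submission
  imports Defs "HOL-Real_Asymp.Real_Asymp"
begin

text \<open>
  Along an orbit started at time \<open>t\<close>, the function \<open>\<xi> \<mapsto> exp (- \<alpha> * \<xi>) * phi U \<alpha> \<xi> (Phi U t u)\<close> is a
  supremum over a shrinking set of times, hence nonincreasing. For negative \<open>\<alpha>\<close> this exponential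
  decay gives the integral bound with \<open>p = 1\<close>. Conversely, the tail integrals \<open>F s\<close> of the \<open>p\<close>-th
  power satisfy \<open>(1 + 1 / K) * F (s + 1) \<le> F s\<close>, so they decay geometrically, and the growth bound
  transfers the decay to the integrand (Datko's argument).
\<close>

section \<open>Real-variable tools: exponential integrals, measurability, Datko's decay
  estimate\<close>

lemma nn_integral_exp_atLeast:
  fixes c t :: real
  assumes "c < 0"
  shows "(\<integral>\<^sup>+\<xi>\<in>{t..}. ennreal (exp (c * (\<xi> - t))) \<partial>lborel) = ennreal (1 / - c)"
proof -
  have lim: "((\<lambda>\<xi>. exp (c * (\<xi> - t)) / c) \<longlongrightarrow> 0) at_top"
    using assms by real_asymp
  have "(\<integral>\<^sup>+\<xi>\<in>{t..}. ennreal (exp (c * (\<xi> - t))) \<partial>lborel) = ennreal (0 - exp (c * (t - t)) / c)"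
    by (rule nn_integral_FTC_atLeast[OF _ _ _ lim])
      (use assms in \<open>auto intro!: derivative_eq_intros\<close>)
  then show ?thesis by simp
qed

text \<open>The growth inequality makes \<open>exp (- a * \<xi>) * f \<xi>\<close> nonincreasing on
  \<open>{t..}\<close>, and monotone functions are Borel. This measurability is what permits
  splitting the integrals of \<open>f\<close> additively.\<close>

lemma borel_measurable_exp_growth:
  fixes f :: "real \<Rightarrow> real"
  assumes growth: "\<And>s \<xi>. t \<le> s \<Longrightarrow> s \<le> \<xi> \<Longrightarrow> f \<xi> \<le> exp (a * (\<xi> - s)) * f s"
  shows "(\<lambda>\<xi>. f \<xi> * indicator {t..} \<xi>) \<in> borel_measurable borel"
proof -
  have "mono_on {t..} (\<lambda>\<xi>. - (exp (- a * \<xi>) * f \<xi>))"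
  proof (rule mono_onI)
    fix r s assume rs: "r \<in> {t..}" "s \<in> {t..}" "r \<le> s"
    have exp_split: "exp (- a * r) = exp (- a * s) * exp (a * (s - r))"
      by (simp add: algebra_simps flip: exp_add)
    have "exp (- a * s) * f s \<le> exp (- a * s) * (exp (a * (s - r)) * f r)"
      using rs by (intro mult_left_mono growth) auto
    also have "\<dots> = exp (- a * r) * f r"
      unfolding exp_split by simp
    finally show "- (exp (- a * r) * f r) \<le> - (exp (- a * s) * f s)" by simp
  qed
  then have "(\<lambda>\<xi>. - (exp (- a * \<xi>) * f \<xi>)) \<in> borel_measurable (restrict_space borel {t..})"
    by (rule borel_measurable_mono_on_fnc)
  then have "(\<lambda>\<xi>. - (exp (- a * \<xi>) * f \<xi>) * indicator {t..} \<xi>) \<in> borel_measurable borel"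
    by (subst (asm) borel_measurable_restrict_space_iff) (auto simp: mult.commute)
  then have "(\<lambda>\<xi>. - exp (a * \<xi>) * (- (exp (- a * \<xi>) * f \<xi>) * indicator {t..} \<xi>)) \<in> borel_measurable borel"
    by measurable
  also have "(\<lambda>\<xi>. - exp (a * \<xi>) * (- (exp (- a * \<xi>) * f \<xi>) * indicator {t..} \<xi>)) =
      (\<lambda>\<xi>. f \<xi> * indicator {t..} \<xi>)"
    by (simp add: fun_eq_iff exp_minus)
  finally show ?thesis .
qed

text \<open>Here \<open>f\<close> stands for the \<open>p\<close>-th power of \<open>phi\<close>
  along one orbit. Each unit of time multiplies the tail integral by at most \<open>r\<close>, the
  inverse of \<open>1 + 1 / K\<close>. In the constant, \<open>K / r\<^sup>2\<close> serves times at
  least \<open>t + 1\<close> and \<open>1 / r\<close> serves earlier ones; adding them covers both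
  cases at once.\<close>

lemma Datko_geometric_decay:
  fixes f :: "real \<Rightarrow> real"
  assumes nonneg: "\<And>s. t \<le> s \<Longrightarrow> 0 \<le> f s"
    and growth: "\<And>s \<xi>. t \<le> s \<Longrightarrow> s \<le> \<xi> \<Longrightarrow> f \<xi> \<le> exp (a * (\<xi> - s)) * f s"
    and tail: "\<And>s. t \<le> s \<Longrightarrow> (\<integral>\<^sup>+\<xi>\<in>{s..}. ennreal (f \<xi>) \<partial>lborel) \<le> ennreal (K * f s)"
    and a: "0 \<le> a" and K: "0 < K" and \<xi>: "t \<le> \<xi>"
  defines "r \<equiv> K / (K + 1)"
  shows "f \<xi> \<le> exp a * (K / r\<^sup>2 + 1 / r) * r powr (\<xi> - t) * f t"
proof -
  define F where "F s = (\<integral>\<^sup>+\<xi>\<in>{s..}. ennreal (f \<xi>) \<partial>lborel)" for s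
  define I where "I s = enn2real (F s)" for s
  have r: "0 < r" "r < 1" using K by (auto simp: r_def)
  \<comment> \<open>Since \<open>enn2real\<close> sends infinity to 0, the tail hypothesis is needed
    to know that \<open>I\<close> represents \<open>F\<close> faithfully from \<open>t\<close>
    on.\<close>
  have FI: "F s = ennreal (I s)" and I_le: "I s \<le> K * f s" if "t \<le> s" for s
  proof -
    have le: "F s \<le> ennreal (K * f s)" using tail[OF that] by (simp add: F_def)
    then have "F s < top" using le_less_trans by fastforce
    then show *: "F s = ennreal (I s)" by (simp add: I_def)
    show "I s \<le> K * f s"
      using le K nonneg[OF that] unfolding * by (subst (asm) ennreal_le_iff) auto
  qed
  have I_nonneg: "0 \<le> I s" for s by (simp add: I_def)
  \<comment> \<open>The integral over \<open>{s..}\<close> splits at \<open>s + 1\<close>, and the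
    first piece is at least \<open>b\<close> because the window has length one. It is used once for
    the decay of \<open>I\<close> and once to return from \<open>I\<close> to
    \<open>f\<close>.\<close>
  have window: "I (s + 1) + b \<le> I s"
    if s: "t \<le> s" and b: "0 \<le> b" "\<And>\<xi>. s \<le> \<xi> \<Longrightarrow> \<xi> < s + 1 \<Longrightarrow> b \<le> f \<xi>" for s b
  proof -
    have m: "(\<lambda>\<xi>. ennreal (f \<xi>) * indicator {s + 1..} \<xi>) \<in> borel_measurable lborel"
    proof -
      have "(\<lambda>\<xi>. f \<xi> * indicator {s + 1..} \<xi>) \<in> borel_measurable borel"
        by (rule borel_measurable_exp_growth[where a = a]) (use s in \<open>auto intro: growth\<close>)
      then have "(\<lambda>\<xi>. ennreal (f \<xi> * indicator {s + 1..} \<xi>)) \<in> borel_measurable borel"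
        by measurable
      also have "(\<lambda>\<xi>. ennreal (f \<xi> * indicator {s + 1..} \<xi>)) =
          (\<lambda>\<xi>. ennreal (f \<xi>) * indicator {s + 1..} \<xi>)"
        by (auto simp: indicator_def)
      finally show ?thesis by simp
    qed
    have "ennreal (I (s + 1) + b) = F (s + 1) + ennreal b"
      using s b by (simp add: FI I_nonneg)
    also have "\<dots> = F (s + 1) + (\<integral>\<^sup>+\<xi>. ennreal b * indicator {s..<s + 1} \<xi> \<partial>lborel)"
      by (simp add: nn_integral_cmult_indicator)
    also have "\<dots> = (\<integral>\<^sup>+\<xi>. ennreal (f \<xi>) * indicator {s + 1..} \<xi> +
        ennreal b * indicator {s..<s + 1} \<xi> \<partial>lborel)"
      unfolding F_def using m by (intro nn_integral_add[symmetric]) auto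
    also have "\<dots> \<le> F s"
      unfolding F_def
      by (intro nn_integral_mono) (use b in \<open>auto simp: indicator_def intro: ennreal_leI\<close>)
    also have "\<dots> = ennreal (I s)" by (rule FI[OF s])
    finally show ?thesis by (simp add: I_nonneg)
  qed
  have antimono: "I s' \<le> I s" if "t \<le> s" "s \<le> s'" for s s'
  proof -
    have "F s' \<le> F s"
      unfolding F_def by (intro nn_integral_mono) (use that in \<open>auto simp: indicator_def\<close>)
    then show ?thesis using that by (simp add: FI I_nonneg)
  qed
  have step: "I (s + 1) \<le> r * I s" if s: "t \<le> s" for s
  proof -
    \<comment> \<open>On the window, \<open>I (s + 1) \<le> I \<xi> \<le> K * f \<xi>\<close>, so
      \<open>I (s + 1) / K\<close> is a lower bound for \<open>f\<close> there.\<close>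
    have "I (s + 1) + I (s + 1) / K \<le> I s"
    proof (rule window[OF s])
      fix \<xi> assume "s \<le> \<xi>" "\<xi> < s + 1"
      then have "I (s + 1) \<le> K * f \<xi>"
        using antimono[of \<xi> "s + 1"] I_le[of \<xi>] s by linarith
      then show "I (s + 1) / K \<le> f \<xi>" using K by (simp add: divide_le_eq mult.commute)
    qed (use K I_nonneg in auto)
    then show ?thesis using K by (simp add: r_def field_simps)
  qed
  have geometric: "I (t + real n) \<le> r ^ n * I t" for n
  proof (induction n)
    case (Suc n)
    have "I (t + real (Suc n)) \<le> r * I (t + real n)"
      using step[of "t + real n"] by (simp add: algebra_simps)
    also have "\<dots> \<le> r * (r ^ n * I t)" using Suc r by simp
    finally show ?case by (simp add: mult.assoc)
  qed simp
  have ft: "0 \<le> f t" using nonneg by simp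
  \<comment> \<open>The negative powers of \<open>r\<close> are absorbed as time shifts: by two
    units in the summand for late times, by one in the summand for early times.\<close>
  have split: "exp a * (K / r\<^sup>2 + 1 / r) * r powr (\<xi> - t) * f t =
      exp a * (K * r powr (\<xi> - t - 2) * f t) + exp a * (r powr (\<xi> - t - 1) * f t)"
  proof -
    have "r powr (\<xi> - t - 2) = r powr (\<xi> - t) / r\<^sup>2" "r powr (\<xi> - t - 1) = r powr (\<xi> - t) / r"
      using r by (simp_all add: powr_diff[of r "\<xi> - t"])
    then show ?thesis by (simp only:) (simp add: distrib_left distrib_right)
  qed
  show ?thesis
  proof (cases "\<xi> < t + 1")
    case True
    have "f \<xi> \<le> exp (a * (\<xi> - t)) * f t" using \<xi> by (intro growth) auto
    also have "\<dots> \<le> exp a * (1 * f t)"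
      using True a ft by (auto intro!: mult_right_mono simp: mult_left_le)
    \<comment> \<open>The exponent is negative and \<open>r < 1\<close>, so the inserted power is at
      least 1.\<close>
    also have "\<dots> \<le> exp a * (r powr (\<xi> - t - 1) * f t)"
    proof -
      have "r powr 0 \<le> r powr (\<xi> - t - 1)"
        using r True by (intro powr_mono') auto
      then show ?thesis using r ft by (intro mult_left_mono mult_right_mono) auto
    qed
    finally show ?thesis
      unfolding split using K ft r by (simp add: add_increasing)
  next
    case False
    \<comment> \<open>The number of whole unit steps from \<open>t\<close> to
      \<open>\<xi> - 1\<close>. Stepping back by one and rounding down together lose at most two
      units, hence the exponent \<open>\<xi> - t - 2\<close>.\<close>
    define n where "n = nat \<lfloor>\<xi> - 1 - t\<rfloor>"
    have n: "real n \<le> \<xi> - 1 - t" "\<xi> - t - 2 \<le> real n"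
      using False unfolding n_def by linarith+
    \<comment> \<open>Read backwards, the growth bound says that \<open>f\<close> was at least
      \<open>exp (- a) * f \<xi>\<close> throughout the unit of time before \<open>\<xi>\<close>;
      this uses \<open>0 \<le> a\<close>.\<close>
    have "exp (- a) * f \<xi> \<le> I (\<xi> - 1)"
    proof -
      have "I (\<xi> - 1 + 1) + exp (- a) * f \<xi> \<le> I (\<xi> - 1)"
      proof (rule window)
        fix \<eta> assume \<eta>: "\<xi> - 1 \<le> \<eta>" "\<eta> < \<xi> - 1 + 1"
        have "f \<xi> \<le> exp (a * (\<xi> - \<eta>)) * f \<eta>" using \<eta> False by (intro growth) auto
        also have "\<dots> \<le> exp a * f \<eta>"
          using \<eta> a False by (auto intro!: mult_right_mono nonneg simp: mult_left_le)
        finally show "exp (- a) * f \<xi> \<le> f \<eta>"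
          by (simp add: exp_minus field_simps)
      qed (use False \<xi> nonneg in auto)
      then show ?thesis using I_nonneg[of "\<xi> - 1 + 1"] by linarith
    qed
    also have "\<dots> \<le> I (t + real n)" using n by (intro antimono) auto
    also have "\<dots> \<le> r ^ n * I t" by (rule geometric)
    also have "\<dots> \<le> r powr (\<xi> - t - 2) * (K * f t)"
    proof (rule mult_mono)
      show "r ^ n \<le> r powr (\<xi> - t - 2)"
        using r n by (subst powr_realpow[symmetric]) (auto intro!: powr_mono')
    qed (use I_le I_nonneg in auto)
    finally have "f \<xi> \<le> exp a * (K * r powr (\<xi> - t - 2) * f t)"
      by (simp add: exp_minus field_simps)
    then show ?thesis
      unfolding split using ft r by (simp add: add_increasing2)
  qed
qed

section \<open>The functional \<open>phi\<close> along orbits of a fixed evolution family\<close>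

context
  fixes U :: "real \<Rightarrow> real \<Rightarrow> 'a::banach \<Rightarrow>\<^sub>L 'a" and \<alpha> :: real
  assumes U: "evolution_family U" and \<alpha>: "\<alpha> \<in> admissible_exponents U"
begin

lemma evolution_id: "0 \<le> t \<Longrightarrow> blinfun_apply (U t t) x = x"
  using U unfolding evolution_family_def by simp

lemma evolution_comp:
  assumes "0 \<le> s" "s \<le> \<tau>" "\<tau> \<le> t"
  shows "blinfun_apply (U t \<tau>) (blinfun_apply (U \<tau> s) x) = blinfun_apply (U t s) x"
proof -
  have "U t \<tau> o\<^sub>L U \<tau> s = U t s"
    using U assms unfolding evolution_family_def by blast
  then show ?thesis by (metis blinfun_apply_blinfun_compose)
qed

lemma phi_upper:
  assumes "0 \<le> t" "t \<le> \<tau>"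
  shows "exp (- \<alpha> * (\<tau> - t)) * norm (blinfun_apply (U \<tau> t) (u t)) \<le> phi U \<alpha> t u"
  unfolding phi_def using assms phi_bdd_above[OF \<alpha>] by (intro cSUP_upper) auto

lemma norm_le_phi: "0 \<le> t \<Longrightarrow> norm (u t) \<le> phi U \<alpha> t u"
  using phi_upper[of t t u] by (simp add: evolution_id)

lemma phi_nonneg: "0 \<le> t \<Longrightarrow> 0 \<le> phi U \<alpha> t u"
  by (rule order_trans[OF norm_ge_zero norm_le_phi])

text \<open>By the cocycle law both suprema concern the same orbit. Once
  \<open>exp (\<alpha> * (\<xi> - s))\<close> is factored out, the left one runs over the smaller
  set \<open>{\<xi>..}\<close> of times.\<close>

lemma phi_Phi_growth:
  assumes "0 \<le> t" "t \<le> s" "s \<le> \<xi>"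
  shows "phi U \<alpha> \<xi> (Phi U t u) \<le> exp (\<alpha> * (\<xi> - s)) * phi U \<alpha> s (Phi U t u)"
proof -
  have "exp (- \<alpha> * (\<tau> - \<xi>)) * norm (blinfun_apply (U \<tau> \<xi>) (Phi U t u \<xi>))
      \<le> exp (\<alpha> * (\<xi> - s)) * phi U \<alpha> s (Phi U t u)" if "\<xi> \<le> \<tau>" for \<tau>
  proof -
    have exp_split: "exp (- \<alpha> * (\<tau> - \<xi>)) = exp (\<alpha> * (\<xi> - s)) * exp (- \<alpha> * (\<tau> - s))"
      by (simp add: algebra_simps flip: exp_add)
    have "exp (- \<alpha> * (\<tau> - \<xi>)) * norm (blinfun_apply (U \<tau> \<xi>) (Phi U t u \<xi>)) =
        exp (\<alpha> * (\<xi> - s)) * (exp (- \<alpha> * (\<tau> - s)) * norm (blinfun_apply (U \<tau> s) (Phi U t u s)))"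
      using assms that
      unfolding exp_split by (simp add: Phi_def evolution_comp)
    also have "\<dots> \<le> exp (\<alpha> * (\<xi> - s)) * phi U \<alpha> s (Phi U t u)"
      using assms that by (intro mult_left_mono phi_upper) auto
    finally show ?thesis .
  qed
  then show ?thesis
    unfolding phi_def[of U \<alpha> \<xi>] by (intro cSUP_least) auto
qed

lemma phi_Phi_self: "0 \<le> t \<Longrightarrow> phi U \<alpha> t (Phi U t u) = phi U \<alpha> t u"
  by (simp add: phi_def Phi_def evolution_id)

text \<open>\<open>phi\<close> at \<open>\<xi>\<close> sees only the value at \<open>\<xi>\<close>,
  which the cocycle law determines from the value at \<open>s\<close>. Thus an integral bound for
  orbits started at \<open>s\<close> controls the tail from \<open>s\<close> of an orbit started at
  \<open>t\<close>.\<close>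

lemma phi_Phi_restart:
  assumes "0 \<le> t" "t \<le> s" "s \<le> \<xi>" "v s = Phi U t u s"
  shows "phi U \<alpha> \<xi> (Phi U s v) = phi U \<alpha> \<xi> (Phi U t u)"
  using assms by (simp add: phi_def Phi_def evolution_comp)

lemma phi_le:
  assumes "\<And>\<tau>. t \<le> \<tau> \<Longrightarrow> norm (U \<tau> t) \<le> m * exp (\<alpha> * (\<tau> - t))"
  shows "phi U \<alpha> t u \<le> m * norm (u t)"
  unfolding phi_def
proof (rule cSUP_least)
  fix \<tau> assume "\<tau> \<in> {t..}"
  then have "norm (blinfun_apply (U \<tau> t) (u t)) \<le> m * exp (\<alpha> * (\<tau> - t)) * norm (u t)"
    using assms[of \<tau>] by (intro order_trans[OF norm_blinfun] mult_right_mono) auto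
  then have "exp (- \<alpha> * (\<tau> - t)) * norm (blinfun_apply (U \<tau> t) (u t)) \<le>
      exp (- \<alpha> * (\<tau> - t)) * (m * exp (\<alpha> * (\<tau> - t)) * norm (u t))"
    by (rule mult_left_mono) simp
  also have "\<dots> = m * norm (u t)"
    by (simp add: exp_minus)
  finally show "exp (- \<alpha> * (\<tau> - t)) * norm (blinfun_apply (U \<tau> t) (u t)) \<le> m * norm (u t)" .
qed auto

text \<open>Constant functions need not have bounded \<open>phi\<close>, since \<open>M\<close> may
  be unbounded. Dividing by \<open>M s\<close> cancels the factor in
  \<open>phi U \<alpha> s u \<le> M s * norm (u s)\<close>, and the factor \<open>M t\<close>
  restores the prescribed value at \<open>t\<close>.\<close>

lemma exists_Cb:
  assumes "0 \<le> t"
  obtains u where "u \<in> Cb U \<alpha>" "u t = x"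
proof -
  obtain M :: "real \<Rightarrow> real" where M: "continuous_on {0..} M" "\<And>s. 0 \<le> s \<Longrightarrow> 0 < M s"
    "\<And>\<tau> s. 0 \<le> s \<Longrightarrow> s \<le> \<tau> \<Longrightarrow> norm (U \<tau> s) \<le> M s * exp (\<alpha> * (\<tau> - s))"
    using \<alpha> unfolding admissible_exponents_def by blast
  define u where "u s = (M t / M s) *\<^sub>R x" for s
  have "continuous_on {0..} u"
    unfolding u_def using M(1,2) by (intro continuous_intros) fastforce+
  moreover have "phi U \<alpha> s u \<le> M t * norm x" if "0 \<le> s" for s
  proof -
    have "phi U \<alpha> s u \<le> M s * norm (u s)"
      using M(3)[OF that] by (rule phi_le)
    also have "\<dots> = M t * norm x"
      using M(2)[OF that] M(2)[OF assms] by (simp add: u_def)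
    finally show ?thesis .
  qed
  ultimately have "u \<in> Cb U \<alpha>"
    unfolding Cb_def cont_halfline_def by (auto intro!: bdd_aboveI2)
  moreover have "u t = x" using M(2)[OF assms] by (simp add: u_def)
  ultimately show thesis by (rule that)
qed

section \<open>The two implications\<close>

lemma integral_bound_of_negative_exponent:
  assumes "\<alpha> < 0" "0 \<le> t"
  shows "(\<integral>\<^sup>+\<xi>\<in>{t..}. ennreal (phi U \<alpha> \<xi> (Phi U t u) powr 1) \<partial>lborel)
      \<le> ennreal (1 / - \<alpha> * phi U \<alpha> t u powr 1)"
proof -
  let ?c = "phi U \<alpha> t u"
  have c: "0 \<le> ?c" using assms phi_nonneg by simp
  have "(\<integral>\<^sup>+\<xi>\<in>{t..}. ennreal (phi U \<alpha> \<xi> (Phi U t u) powr 1) \<partial>lborel) \<le>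
      (\<integral>\<^sup>+\<xi>. ennreal ?c * (ennreal (exp (\<alpha> * (\<xi> - t))) * indicator {t..} \<xi>) \<partial>lborel)"
  proof (rule nn_integral_mono)
    fix \<xi>
    \<comment> \<open>Taking \<open>s = t\<close> in the growth estimate, where
      \<open>phi_Phi_self\<close> removes \<open>Phi\<close>, leaves a pure exponential as
      majorant.\<close>
    show "ennreal (phi U \<alpha> \<xi> (Phi U t u) powr 1) * indicator {t..} \<xi> \<le>
        ennreal ?c * (ennreal (exp (\<alpha> * (\<xi> - t))) * indicator {t..} \<xi>)"
      using phi_Phi_growth[of t t \<xi> u] phi_nonneg[of \<xi> "Phi U t u"] assms c
      by (auto simp: indicator_def phi_Phi_self mult.commute ennreal_mult[symmetric] intro!: ennreal_leI)
  qed
  also have "\<dots> = ennreal ?c * (\<integral>\<^sup>+\<xi>\<in>{t..}. ennreal (exp (\<alpha> * (\<xi> - t))) \<partial>lborel)"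
    by (rule nn_integral_cmult) measurable
  also have "\<dots> = ennreal (1 / - \<alpha> * ?c powr 1)"
    using nn_integral_exp_atLeast[of \<alpha> t] assms c
    by (simp add: ennreal_mult[symmetric])
  finally show ?thesis .
qed

lemma stable_of_integral_bound:
  fixes p K :: real
  assumes p: "0 < p" and K: "0 < K"
    and bound: "\<And>t u. 0 \<le> t \<Longrightarrow> u \<in> Cb U \<alpha> \<Longrightarrow>
      (\<integral>\<^sup>+\<xi>\<in>{t..}. ennreal (phi U \<alpha> \<xi> (Phi U t u) powr p) \<partial>lborel)
        \<le> ennreal (K * phi U \<alpha> t u powr p)"
  shows "nonuniform_exponentially_stable U"
proof (cases "\<alpha> < 0")
  case True
  then show ?thesis using \<alpha> unfolding nonuniform_exponentially_stable_def by blast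
next
  case False
  \<comment> \<open>Now \<open>\<alpha>\<close> is nonnegative, so Datko's estimate applies with
    \<open>a = p * \<alpha>\<close>. Its \<open>p\<close>-th root yields the constant
    \<open>C\<close> and turns the base \<open>r\<close> into the negative exponent
    \<open>\<nu>\<close>.\<close>
  define r where "r = K / (K + 1)"
  define C where "C = (exp (p * \<alpha>) * (K / r\<^sup>2 + 1 / r)) powr (1 / p)"
  define \<nu> where "\<nu> = ln r / p"
  have r: "0 < r" "r < 1" using K by (auto simp: r_def)
  have \<nu>: "\<nu> < 0" using r p by (simp add: \<nu>_def divide_neg_pos)
  have C: "0 < C" using r K by (simp add: C_def add_pos_pos less_imp_neq[symmetric])
  obtain M :: "real \<Rightarrow> real" where M: "continuous_on {0..} M" "\<And>s. 0 \<le> s \<Longrightarrow> 0 < M s"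
    "\<And>\<tau> s. 0 \<le> s \<Longrightarrow> s \<le> \<tau> \<Longrightarrow> norm (U \<tau> s) \<le> M s * exp (\<alpha> * (\<tau> - s))"
    using \<alpha> unfolding admissible_exponents_def by blast
  have "norm (U \<xi> t) \<le> C * M t * exp (\<nu> * (\<xi> - t))" if t: "0 \<le> t" and \<xi>: "t \<le> \<xi>" for t \<xi>
  proof (rule norm_blinfun_bound)
    show "0 \<le> C * M t * exp (\<nu> * (\<xi> - t))" using C M(2)[OF t] by simp
    fix x
    define u :: "real \<Rightarrow> 'a" where "u = (\<lambda>_. x)"
    define g where "g \<eta> = phi U \<alpha> \<eta> (Phi U t u)" for \<eta>
    have g_nonneg: "0 \<le> g \<eta>" if "t \<le> \<eta>" for \<eta>
      using that t phi_nonneg by (simp add: g_def)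
    have "g \<xi> powr p \<le>
        exp (p * \<alpha>) * (K / r\<^sup>2 + 1 / r) * r powr (\<xi> - t) * g t powr p"
      unfolding r_def
    proof (rule Datko_geometric_decay[where f = "\<lambda>\<eta>. g \<eta> powr p"])
      fix s \<eta> assume "t \<le> s" "s \<le> \<eta>"
      then have "g \<eta> powr p \<le> (exp (\<alpha> * (\<eta> - s)) * g s) powr p"
        using t p g_nonneg phi_Phi_growth[of t s \<eta> u] by (intro powr_mono2) (auto simp: g_def)
      also have "\<dots> = exp (p * \<alpha> * (\<eta> - s)) * g s powr p"
        using g_nonneg \<open>t \<le> s\<close> by (simp add: powr_mult exp_powr_real algebra_simps)
      finally show "g \<eta> powr p \<le> exp (p * \<alpha> * (\<eta> - s)) * g s powr p" .
    next
      fix s assume s: "t \<le> s"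
      \<comment> \<open>The hypothesis concerns members of \<open>Cb\<close> and integrals starting
        with the orbit, so the orbit is restarted at \<open>s\<close> from a member of
        \<open>Cb\<close> that meets it there.\<close>
      obtain v where v: "v \<in> Cb U \<alpha>" "v s = Phi U t u s"
        using exists_Cb[of s] t s by auto
      have restart: "phi U \<alpha> \<eta> (Phi U s v) = g \<eta>" if "s \<le> \<eta>" for \<eta>
        unfolding g_def using t s that v(2) by (intro phi_Phi_restart)
      have "(\<integral>\<^sup>+\<eta>\<in>{s..}. ennreal (g \<eta> powr p) \<partial>lborel) =
          (\<integral>\<^sup>+\<eta>\<in>{s..}. ennreal (phi U \<alpha> \<eta> (Phi U s v) powr p) \<partial>lborel)"
        by (intro nn_integral_cong) (auto simp: restart indicator_def)
      also have "\<dots> \<le> ennreal (K * phi U \<alpha> s v powr p)"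
        using t s v(1) by (intro bound) auto
      also have "phi U \<alpha> s v = g s"
        using restart[of s] t s by (simp add: phi_Phi_self)
      finally show "(\<integral>\<^sup>+\<eta>\<in>{s..}. ennreal (g \<eta> powr p) \<partial>lborel) \<le> ennreal (K * g s powr p)" .
    qed (use p K \<xi> False in auto)
    then have "(g \<xi> powr p) powr (1 / p) \<le>
        (exp (p * \<alpha>) * (K / r\<^sup>2 + 1 / r) * r powr (\<xi> - t) * g t powr p) powr (1 / p)"
      using p by (intro powr_mono2) auto
    also have "\<dots> = C * (r powr (\<xi> - t)) powr (1 / p) * (g t powr p) powr (1 / p)"
      unfolding C_def using r K by (simp only: powr_mult)
    also have "(r powr (\<xi> - t)) powr (1 / p) = exp (\<nu> * (\<xi> - t))"
      using r by (simp add: powr_powr \<nu>_def) (simp add: powr_def mult.commute)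
    finally have "g \<xi> \<le> C * exp (\<nu> * (\<xi> - t)) * g t"
      using p \<xi> g_nonneg by (simp add: powr_powr)
    \<comment> \<open>The nonuniform factor enters only through the starting value of
      \<open>phi\<close>, so the new bound is a constant multiple of \<open>M\<close> and remains
      continuous and positive.\<close>
    also have "\<dots> \<le> C * exp (\<nu> * (\<xi> - t)) * (M t * norm x)"
    proof (intro mult_left_mono)
      show "g t \<le> M t * norm x"
        using phi_le[of t "M t" u] M(3)[OF t] by (simp add: g_def phi_Phi_self[OF t] u_def)
    qed (use C in auto)
    finally have "g \<xi> \<le> C * M t * exp (\<nu> * (\<xi> - t)) * norm x" by (simp add: mult_ac)
    moreover have "norm (blinfun_apply (U \<xi> t) x) \<le> g \<xi>"
      using norm_le_phi[of \<xi> "Phi U t u"] t \<xi> by (simp add: g_def Phi_def u_def)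
    ultimately show "norm (blinfun_apply (U \<xi> t) x) \<le> C * M t * exp (\<nu> * (\<xi> - t)) * norm x"
      by simp
  qed
  moreover have "continuous_on {0..} (\<lambda>t. C * M t)"
    using M(1) by (intro continuous_intros)
  ultimately have "\<nu> \<in> admissible_exponents U"
    unfolding admissible_exponents_def using C M(2)
    by (auto intro!: exI[of _ "\<lambda>t. C * M t"])
  then show ?thesis using \<nu> unfolding nonuniform_exponentially_stable_def by blast
qed

end

theorem corollary3p8:
  fixes U :: "real \<Rightarrow> real \<Rightarrow> 'a::banach \<Rightarrow>\<^sub>L 'a"
  assumes "evolution_family U"
    and "nonuniform_exponentially_bounded U"
  shows "nonuniform_exponentially_stable U \<longleftrightarrow>
    (\<exists>\<alpha>\<in>admissible_exponents U. \<exists>p K :: real. p > 0 \<and> K > 0 \<and>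
      (\<forall>t\<ge>0. \<forall>u\<in>Cb U \<alpha>.
        (\<integral>\<^sup>+\<xi>\<in>{t..}. ennreal (phi U \<alpha> \<xi> (Phi U t u) powr p) \<partial>lborel)
          \<le> ennreal (K * phi U \<alpha> t u powr p)))"
    (is "_ \<longleftrightarrow> ?bound")
proof
  assume "nonuniform_exponentially_stable U"
  then obtain \<alpha> where \<alpha>: "\<alpha> \<in> admissible_exponents U" "\<alpha> < 0"
    unfolding nonuniform_exponentially_stable_def by blast
  show ?bound
  proof (rule bexI[OF _ \<alpha>(1)], rule exI[of _ 1], rule exI[of _ "1 / - \<alpha>"],
      intro conjI allI impI ballI)
    fix t :: real and u
    assume "0 \<le> t"
    then show "(\<integral>\<^sup>+\<xi>\<in>{t..}. ennreal (phi U \<alpha> \<xi> (Phi U t u) powr 1) \<partial>lborel)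
        \<le> ennreal (1 / - \<alpha> * phi U \<alpha> t u powr 1)"
      by (rule integral_bound_of_negative_exponent[OF assms(1) \<alpha>])
  qed (use \<alpha> in auto)
next
  assume ?bound
  then show "nonuniform_exponentially_stable U"
    using stable_of_integral_bound[OF assms(1)] by blast
qed

end
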